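(* Let $n\ge1$, $d_n=\dim_{\mathbb R}\mathfrak{sl}(2n+1,\mathbb C)=8n(n+1)$, and equip $\mathrm{SL}(2n+1,\mathbb C)$ with the left-invariant hypercomplex structure $\{J_1,J_2,J_3\}$ induced by the complex product structure $\{J,E\}$ of $\mathfrak{sl}(2n+1,\mathbb R)$ described in the context. The holonomy group of its Obata connection is not contained in $\mathrm{SL}(\tfrac14d_n,\mathbb H)$.
   Context: Write elements of $\mathfrak{sl}(2n+1,\mathbb R)$ as $\begin{bmatrix}A&w\\ v^t&-\operatorname{tr}A\end{bmatrix}\leftrightarrow(A,v,w)$ with $A\in\mathfrak{gl}(2n,\mathbb R)$, $v,w\in\mathbb R^{2n}$. Let $J_0=\begin{bmatrix}0&-I_n\\ I_n&0\end{bmatrix}$, $E_0=\begin{bmatrix}I_n&0\\ 0&-I_n\end{bmatrix}$, and set $J(A,v,w)=(AJ_0,-J_0v,-J_0w)$, $E(A,v,w)=(AE_0,E_0v,-E_0w)$. Let $\mathfrak s_\pm$ be the $(\pm1)$-eigenspaces of $E$. On $\mathfrak{sl}(2n+1,\mathbb C)=\mathfrak{sl}(2n+1,\mathbb R)\oplus i\,\mathfrak{sl}(2n+1,\mathbb R)$, viewed as a real Lie algebra, define $J_1(x+iy)=Jx+iJy$; $J_2(x+iy)=i(x+iy)$ for $x,y\in\mathfrak s_+$ and $J_2(x+iy)=-i(x+iy)$ for $x,y\in\mathfrak s_-$ (extended additively); $J_3=J_1J_2$. This is a hypercomplex structure, and determines a left-invariant one on $\mathrm{SL}(2n+1,\mathbb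 C)$. The Obata connection of a hypercomplex manifold is the unique torsion-free connection for which all $J_\alpha$ are parallel. For a $4m$-dimensional hypercomplex manifold its holonomy group is contained in $\mathrm{GL}(m,\mathbb H)$, the group of invertible real endomorphisms of a tangent space commuting with $J_1,J_2,J_3$. $\mathrm{SL}(m,\mathbb H)$ is the commutator subgroup of $\mathrm{GL}(m,\mathbb H)$. *)

theory Defs
  imports "HOL-Analysis.Analysis" "HOL-Algebra.Bij" "HOL-Algebra.Generated_Groups"
begin

section \<open>The matrix groups and Lie algebras\<close>

definition sl :: "('a::comm_ring_1^'m^'m) set" where
  "sl = {X. trace X = 0}"

definition SL :: "('a::comm_ring_1^'m^'m) set" where
  "SL = {g. det g = 1}"

definition lie_bracket :: "'a::comm_ring_1^'m^'m \<Rightarrow> 'a^'m^'m \<Rightarrow> 'a^'m^'m" where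
  "lie_bracket X Y = X ** Y - Y ** X"

text \<open>
  With \<open>n = CARD('n) \<ge> 1\<close>, rows and columns of a \<open>(2n+1) \<times> (2n+1)\<close> matrix are indexed by
  \<open>('n + 'n) option\<close>: the indices \<open>Some (Inl i)\<close> and \<open>Some (Inr i)\<close> are the first and second
  \<open>n\<close> coordinates, and \<open>None\<close> is the last one.
\<close>

type_synonym ('a, 'n) mat_odd = "'a^(('n + 'n) option)^(('n + 'n) option)"


section \<open>The complex product structure on the real Lie algebra\<close>

text \<open>\<open>triple A v w\<close> is the block matrix with rows \<open>(A, w)\<close> and \<open>(v\<^sup>t, - tr A)\<close>.\<close>

definition triple ::
  "real^('n::finite + 'n)^('n + 'n) \<Rightarrow> real^('n + 'n) \<Rightarrow> real^('n + 'n) \<Rightarrow> (real, 'n) mat_odd" where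
  "triple A v w = (\<chi> i j.
     case i of
       Some a \<Rightarrow> (case j of Some b \<Rightarrow> A $ a $ b | None \<Rightarrow> w $ a)
     | None \<Rightarrow> (case j of Some b \<Rightarrow> v $ b | None \<Rightarrow> - trace A))"

definition part_A :: "(real, 'n::finite) mat_odd \<Rightarrow> real^('n + 'n)^('n + 'n)" where
  "part_A X = (\<chi> a b. X $ Some a $ Some b)"

definition part_v :: "(real, 'n::finite) mat_odd \<Rightarrow> real^('n + 'n)" where
  "part_v X = (\<chi> b. X $ None $ Some b)"

definition part_w :: "(real, 'n::finite) mat_odd \<Rightarrow> real^('n + 'n)" where
  "part_w X = (\<chi> a. X $ Some a $ None)"

lemma triple_in_sl: "triple A v w \<in> sl"
  by (simp add: sl_def triple_def trace_def UNIV_option_conv sum.reindex)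

lemma triple_parts:
  assumes "X \<in> sl"
  shows "triple (part_A X) (part_v X) (part_w X) = X"
proof -
  have "X $ None $ None = - trace (part_A X)"
    using assms
    by (simp add: sl_def part_A_def trace_def UNIV_option_conv sum.reindex add_eq_0_iff2)
  then show ?thesis
    by (simp add: triple_def part_A_def part_v_def part_w_def vec_eq_iff split: option.splits)
qed

definition J0 :: "real^('n::finite + 'n)^('n + 'n)" where
  "J0 = (\<chi> i j.
     case (i, j) of
       (Inl a, Inr b) \<Rightarrow> if a = b then - 1 else 0
     | (Inr a, Inl b) \<Rightarrow> if a = b then 1 else 0
     | _ \<Rightarrow> 0)"

definition E0 :: "real^('n::finite + 'n)^('n + 'n)" where
  "E0 = (\<chi> i j.
     case (i, j) of
       (Inl a, Inl b) \<Rightarrow> if a = b then 1 else 0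
     | (Inr a, Inr b) \<Rightarrow> if a = b then - 1 else 0
     | _ \<Rightarrow> 0)"

definition J_sl :: "(real, 'n::finite) mat_odd \<Rightarrow> (real, 'n) mat_odd" where
  "J_sl X = triple (part_A X ** J0) (- (J0 *v part_v X)) (- (J0 *v part_w X))"

definition E_sl :: "(real, 'n::finite) mat_odd \<Rightarrow> (real, 'n) mat_odd" where
  "E_sl X = triple (part_A X ** E0) (E0 *v part_v X) (- (E0 *v part_w X))"

definition s_plus :: "(real, 'n::finite) mat_odd set" where
  "s_plus = {x \<in> sl. E_sl x = x}"

definition s_minus :: "(real, 'n::finite) mat_odd set" where
  "s_minus = {x \<in> sl. E_sl x = - x}"


section \<open>The hypercomplex structure on the complexification\<close>

definition cmat :: "(real, 'n::finite) mat_odd \<Rightarrow> (real, 'n) mat_odd \<Rightarrow> (complex, 'n) mat_odd" where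
  "cmat x y = (\<chi> i j. Complex (x $ i $ j) (y $ i $ j))"

definition Re_mat :: "(complex, 'n::finite) mat_odd \<Rightarrow> (real, 'n) mat_odd" where
  "Re_mat Z = (\<chi> i j. Re (Z $ i $ j))"

definition Im_mat :: "(complex, 'n::finite) mat_odd \<Rightarrow> (real, 'n) mat_odd" where
  "Im_mat Z = (\<chi> i j. Im (Z $ i $ j))"

definition i_times :: "(complex, 'n::finite) mat_odd \<Rightarrow> (complex, 'n) mat_odd" where
  "i_times Z = (\<chi> i j. \<i> * Z $ i $ j)"

definition J1 :: "(complex, 'n::finite) mat_odd \<Rightarrow> (complex, 'n) mat_odd" where
  "J1 Z = cmat (J_sl (Re_mat Z)) (J_sl (Im_mat Z))"

text \<open>
  As \<open>E\<^sup>2 = id\<close>, the projections of \<open>sl = s_plus \<oplus> s_minus\<close> onto its summands are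
  \<open>(id \<plusminus> E) / 2\<close>; the lemmas \<open>J2_s_plus\<close> and \<open>J2_s_minus\<close> below recover the two defining
  clauses of the second complex structure.
\<close>

definition proj_plus :: "(real, 'n::finite) mat_odd \<Rightarrow> (real, 'n) mat_odd" where
  "proj_plus x = (1/2) *\<^sub>R (x + E_sl x)"

definition proj_minus :: "(real, 'n::finite) mat_odd \<Rightarrow> (real, 'n) mat_odd" where
  "proj_minus x = (1/2) *\<^sub>R (x - E_sl x)"

definition J2 :: "(complex, 'n::finite) mat_odd \<Rightarrow> (complex, 'n) mat_odd" where
  "J2 Z = i_times (cmat (proj_plus (Re_mat Z)) (proj_plus (Im_mat Z)))
        - i_times (cmat (proj_minus (Re_mat Z)) (proj_minus (Im_mat Z)))"

definition J3 :: "(complex, 'n::finite) mat_odd \<Rightarrow> (complex, 'n) mat_odd" where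
  "J3 Z = J1 (J2 Z)"

lemma Re_mat_cmat [simp]: "Re_mat (cmat x y) = x"
  and Im_mat_cmat [simp]: "Im_mat (cmat x y) = y"
  and cmat_Re_Im [simp]: "cmat (Re_mat Z) (Im_mat Z) = Z"
  by (simp_all add: Re_mat_def Im_mat_def cmat_def vec_eq_iff)

lemma J2_s_plus:
  assumes "x \<in> s_plus" "y \<in> s_plus"
  shows "J2 (cmat x y) = i_times (cmat x y)"
  using assms
  by (simp add: J2_def s_plus_def proj_plus_def proj_minus_def)
     (simp add: vec_eq_iff i_times_def cmat_def complex_eq_iff)

lemma J2_s_minus:
  assumes "x \<in> s_minus" "y \<in> s_minus"
  shows "J2 (cmat x y) = - i_times (cmat x y)"
  using assms
  by (simp add: J2_def s_minus_def proj_plus_def proj_minus_def)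
     (simp add: vec_eq_iff i_times_def cmat_def complex_eq_iff)


section \<open>Smooth curves\<close>

text \<open>
  \<open>f\<close> is infinitely differentiable on the closed interval, with one-sided derivatives at the
  end points.
\<close>

definition smooth_on_interval :: "(real \<Rightarrow> 'v::real_normed_vector) \<Rightarrow> real \<Rightarrow> real \<Rightarrow> bool" where
  "smooth_on_interval f a b \<longleftrightarrow>
     (\<exists>F. F 0 = f \<and>
        (\<forall>k. \<forall>t\<in>{a..b}. (F k has_vector_derivative F (Suc k) t) (at t within {a..b})))"

text \<open>
  A piecewise smooth loop at \<open>p\<close> in the group \<open>SL\<close>, parametrised by \<open>[\<tau> 0, \<tau> k]\<close> and smooth
  on each of the intervals \<open>[\<tau> i, \<tau> (i + 1)]\<close>.
\<close>

definition piecewise_smooth_loop ::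
  "(real \<Rightarrow> complex^'m^'m) \<Rightarrow> (nat \<Rightarrow> real) \<Rightarrow> nat \<Rightarrow> complex^'m^'m \<Rightarrow> bool" where
  "piecewise_smooth_loop \<gamma> \<tau> k p \<longleftrightarrow>
     (\<forall>i<k. \<tau> i < \<tau> (Suc i) \<and> smooth_on_interval \<gamma> (\<tau> i) (\<tau> (Suc i))) \<and>
     (\<forall>t\<in>{\<tau> 0..\<tau> k}. \<gamma> t \<in> SL) \<and> \<gamma> (\<tau> 0) = p \<and> \<gamma> (\<tau> k) = p"


section \<open>Affine connections on the group\<close>

text \<open>
  The tangent space of \<open>SL\<close> at \<open>g\<close> is \<open>{g ** X | X \<in> sl}\<close>. Everything is written in the left
  trivialisation \<open>g ** X \<leftrightarrow> X\<close>, so that left-invariant vector fields and left-invariant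
  endomorphism fields become constants. An affine connection \<open>\<nabla>\<close>, not assumed to be
  left-invariant, is given by \<open>\<Gamma> g x y = (\<nabla>\<^sub>x y)(g)\<close>, where \<open>x, y \<in> sl\<close> are regarded as
  left-invariant vector fields.  Since these fields form a global frame, every \<open>\<Gamma>\<close> which is
  bilinear in \<open>x, y\<close> and smooth in \<open>g\<close> arises from exactly one connection. Values of \<open>\<Gamma>\<close>
  outside \<open>SL \<times> sl \<times> sl\<close> are irrelevant.

  By Boman's theorem, a map on a manifold is smooth if and only if its compositions with all
  smooth curves are smooth; this is how smoothness in \<open>g\<close> is expressed.
\<close>

definition real_linear_on ::
  "'v::real_vector set \<Rightarrow> ('v \<Rightarrow> 'w::real_vector) \<Rightarrow> bool" where
  "real_linear_on S f \<longleftrightarrow>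
     (\<forall>x\<in>S. \<forall>y\<in>S. f (x + y) = f x + f y) \<and> (\<forall>r. \<forall>x\<in>S. f (r *\<^sub>R x) = r *\<^sub>R f x)"

type_synonym 'm connection = "complex^'m^'m \<Rightarrow> complex^'m^'m \<Rightarrow> complex^'m^'m \<Rightarrow> complex^'m^'m"

definition affine_connection :: "('m::finite) connection \<Rightarrow> bool" where
  "affine_connection \<Gamma> \<longleftrightarrow>
     (\<forall>g\<in>SL. \<forall>x\<in>sl. \<forall>y\<in>sl. \<Gamma> g x y \<in> sl) \<and>
     (\<forall>g\<in>SL. \<forall>x\<in>sl. real_linear_on sl (\<lambda>y. \<Gamma> g x y)) \<and>
     (\<forall>g\<in>SL. \<forall>y\<in>sl. real_linear_on sl (\<lambda>x. \<Gamma> g x y)) \<and>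
     (\<forall>c a b. a < b \<and> smooth_on_interval c a b \<and> (\<forall>t\<in>{a..b}. c t \<in> SL) \<longrightarrow>
        (\<forall>x\<in>sl. \<forall>y\<in>sl. smooth_on_interval (\<lambda>t. \<Gamma> (c t) x y) a b))"

text \<open>
  The torsion and the covariant derivative of an endomorphism field are tensors, hence it suffices
  to evaluate them on left-invariant fields. The commutator of the left-invariant fields \<open>x\<close> and
  \<open>y\<close> is the left-invariant field \<open>lie_bracket x y\<close>, and a left-invariant endomorphism field \<open>T\<close>
  satisfies \<open>(\<nabla>\<^sub>x T) y = \<nabla>\<^sub>x (T y) - T (\<nabla>\<^sub>x y)\<close>.
\<close>

definition torsion_free :: "('m::finite) connection \<Rightarrow> bool" where
  "torsion_free \<Gamma> \<longleftrightarrow>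
     (\<forall>g\<in>SL. \<forall>x\<in>sl. \<forall>y\<in>sl. \<Gamma> g x y - \<Gamma> g y x - lie_bracket x y = 0)"

definition parallel_endo ::
  "('m::finite) connection \<Rightarrow> (complex^'m^'m \<Rightarrow> complex^'m^'m) \<Rightarrow> bool" where
  "parallel_endo \<Gamma> T \<longleftrightarrow>
     (\<forall>g\<in>SL. \<forall>x\<in>sl. \<forall>y\<in>sl. \<Gamma> g x (T y) - T (\<Gamma> g x y) = 0)"

definition obata_connection :: "(('n::finite + 'n) option) connection \<Rightarrow> bool" where
  "obata_connection \<Gamma> \<longleftrightarrow>
     affine_connection \<Gamma> \<and> torsion_free \<Gamma> \<and>
     parallel_endo \<Gamma> J1 \<and> parallel_endo \<Gamma> J2 \<and> parallel_endo \<Gamma> J3"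


section \<open>Holonomy\<close>

text \<open>
  The vector field \<open>t \<mapsto> \<gamma> t ** y t\<close> along \<open>\<gamma>\<close> has covariant derivative
  \<open>\<gamma> t ** (y' t + \<Gamma> (\<gamma> t) (\<gamma> t\<^sup>-\<^sup>1 ** \<gamma>' t) (y t))\<close>.
\<close>

definition parallel_along ::
  "('m::finite) connection \<Rightarrow> (real \<Rightarrow> complex^'m^'m) \<Rightarrow> (nat \<Rightarrow> real) \<Rightarrow> nat
     \<Rightarrow> (real \<Rightarrow> complex^'m^'m) \<Rightarrow> bool" where
  "parallel_along \<Gamma> \<gamma> \<tau> k y \<longleftrightarrow>
     (\<forall>t\<in>{\<tau> 0..\<tau> k}. y t \<in> sl) \<and>
     (\<forall>i<k. \<forall>t\<in>{\<tau> i..\<tau> (Suc i)}.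
        (y has_vector_derivative
           - \<Gamma> (\<gamma> t)
               (matrix_inv (\<gamma> t) ** vector_derivative \<gamma> (at t within {\<tau> i..\<tau> (Suc i)}))
               (y t))
          (at t within {\<tau> i..\<tau> (Suc i)}))"

text \<open>
  The holonomy group at \<open>p\<close>, acting on the tangent space at \<open>p\<close> identified with \<open>sl\<close>. As in
  \<^const>\<open>BijGroup\<close>, maps of \<open>sl\<close> are normalised outside \<open>sl\<close> by \<^const>\<open>extensional\<close>.
\<close>

definition holonomy_group ::
  "('m::finite) connection \<Rightarrow> complex^'m^'m \<Rightarrow> (complex^'m^'m \<Rightarrow> complex^'m^'m) set" where
  "holonomy_group \<Gamma> p =
     {P \<in> extensional sl. \<exists>\<gamma> \<tau> k. piecewise_smooth_loop \<gamma> \<tau> k p \<and>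
        (\<forall>u\<in>sl. \<exists>y. parallel_along \<Gamma> \<gamma> \<tau> k y \<and> y (\<tau> 0) = u \<and> P u = y (\<tau> k))}"


section \<open>The quaternionic linear groups\<close>

text \<open>
  The groups \<open>GL(m, H)\<close> and \<open>SL(m, H)\<close> of the tangent space \<open>sl\<close>, which has real dimension
  \<open>4 m = 8 n (n + 1)\<close>.
\<close>

definition GL_H :: "((complex, 'n::finite) mat_odd \<Rightarrow> (complex, 'n) mat_odd) set" where
  "GL_H = {f \<in> carrier (BijGroup sl). real_linear_on sl f \<and>
     (\<forall>x\<in>sl. f (J1 x) = J1 (f x) \<and> f (J2 x) = J2 (f x) \<and> f (J3 x) = J3 (f x))}"

definition SL_H :: "((complex, 'n::finite) mat_odd \<Rightarrow> (complex, 'n) mat_odd) set" where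
  "SL_H = derived (BijGroup sl) GL_H"

end

theory Submission
  imports Defs
begin

text \<open>
  Torsion-freeness and parallelism of the complex structures express \<open>2 \<nabla>\<^sub>x y\<close> as
  \<open>[x, y] + J\<^sub>1[J\<^sub>1x, y] - J\<^sub>2[x, J\<^sub>2y] + J\<^sub>3[J\<^sub>1x, J\<^sub>2y]\<close>, so the Obata connection is left-invariant.
  Let \<open>e = E\<^sub>l\<^sub>0\<close>, \<open>f = E\<^sub>0\<^sub>l\<close> and \<open>h = E\<^sub>l\<^sub>l - E\<^sub>0\<^sub>0\<close>, where \<open>0\<close> is the last index and \<open>l\<close> one of the
  first \<open>n\<close>. The endomorphisms \<open>\<nabla>\<^sub>e\<close> and \<open>\<nabla>\<^sub>f\<close> have square zero, whereas \<open>\<nabla>\<^sub>h\<close> is diagonal with complex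
  trace \<open>2(n + 1)\<close>. The relation
  \<open>exp(2e) exp(-f/2) exp(e) exp(f) exp(-e) exp(-ln 2 h) = 1\<close>
  in \<open>SL\<^sub>2\<close> closes up to a loop made of six one-parameter curves. The parallel transport along it is a
  product of exponentials of multiples of \<open>\<nabla>\<^sub>e\<close>, \<open>\<nabla>\<^sub>f\<close>, \<open>\<nabla>\<^sub>h\<close>, and only the last factor
  contributes to its real determinant, which is \<open>2\<close> to the power \<open>4(n + 1)\<close>. On the commutator subgroup
  of the quaternionic linear group the real determinant is \<open>1\<close>.
\<close>

section \<open>Determinants\<close>

text \<open>Since \<open>(1 + tN)(1 - tN) = 1\<close>, the polynomial
  \<open>q(t) = det(1 + tN)\<close> satisfies \<open>q(t) q(-t) = 1\<close>. It is therefore a unit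
  of the polynomial ring, hence constant, with value \<open>q(0) = 1\<close>.\<close>

lemma det_mat_1_plus_nilpotent:
  fixes N :: "'a::{field_char_0}^'k^'k"
  assumes "N ** N = 0"
  shows "det (\<chi> i j. (if i = j then 1 else 0) + t * N $ i $ j) = 1"
proof -
  let ?M = "\<lambda>t. (\<chi> i j. (if i = j then 1 else 0) + t * N $ i $ j) :: 'a^'k^'k"
  define q where "q = (\<Sum>p | p permutes (UNIV::'k set). of_int (sign p) *
      (\<Prod>i\<in>UNIV. [:if i = p i then 1 else 0, N $ i $ p i:]))"
  have q: "poly q t = det (?M t)" for t
    by (simp add: q_def det_def poly_sum poly_prod)
  have "?M t ** ?M (- t) = mat 1" for t
  proof -
    have "(?M t ** ?M (- t)) $ i $ j = (mat 1 :: 'a^'k^'k) $ i $ j" for i j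
    proof -
      have "(?M t ** ?M (- t)) $ i $ j =
          (\<Sum>k\<in>UNIV. (if i = k then if k = j then 1 else 0 else 0)
            - (if i = k then t * N $ k $ j else 0) + (if k = j then t * N $ i $ k else 0)
            - t\<^sup>2 * (N $ i $ k * N $ k $ j))"
        unfolding matrix_matrix_mult_def
        by (auto simp: algebra_simps power2_eq_square intro!: sum.cong)
      also have "\<dots> = (if i = j then 1 else 0) - t * N $ i $ j + t * N $ i $ j - t\<^sup>2 * ((N ** N) $ i $ j)"
        by (simp add: sum.distrib sum_subtractf sum_distrib_left[symmetric] matrix_matrix_mult_def)
      finally show ?thesis
        using assms by (simp add: mat_def)
    qed
    then show ?thesis unfolding vec_eq_iff by blast
  qed
  then have "det (?M t) * det (?M (- t)) = 1" for t
    unfolding det_mul[symmetric] by simp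
  then have "poly (q * pcompose q [:0, -1:]) t = poly 1 t" for t
    by (simp add: poly_pcompose q del: mult_minus_left)
  then have "q * pcompose q [:0, -1:] = 1"
    using poly_eq_poly_eq_iff by blast
  then have "q dvd 1" by (metis dvd_triv_left)
  then obtain c where c: "q = [:c:]"
    by (auto elim: is_unit_polyE)
  have "det (?M 0) = 1"
    using det_I[where 'a='a and 'n='k] by (simp add: mat_def)
  then show ?thesis
    using q[of 0] q[of t] c by simp
qed

section \<open>The hypercomplex structure in coordinates\<close>

lemma sum_UNIV_sum:
  fixes f :: "'a::finite + 'b::finite \<Rightarrow> 'c::comm_monoid_add"
  shows "sum f UNIV = (\<Sum>a\<in>UNIV. f (Inl a)) + (\<Sum>b\<in>UNIV. f (Inr b))"
  by (simp add: UNIV_Plus_UNIV[symmetric] sum.Plus o_def del: UNIV_Plus_UNIV)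

lemma sum_UNIV_option:
  fixes f :: "'a::finite option \<Rightarrow> 'c::comm_monoid_add"
  shows "sum f UNIV = f None + (\<Sum>a\<in>UNIV. f (Some a))"
  by (simp add: UNIV_option_conv sum.reindex)

lemma sl_iff:
  "X \<in> sl \<longleftrightarrow> X $ None $ None = - (\<Sum>a\<in>UNIV. X $ Some a $ Some a)"
  for X :: "'a::comm_ring_1^('k::finite option)^('k option)"
  by (simp add: sl_def trace_def sum_UNIV_option eq_neg_iff_add_eq_0)

text \<open>The corner of a traceless matrix is determined by the other diagonal entries. The
  premises are split into blocks in the way \<open>J1\<close> and \<open>J2\<close> act, so that
  their entry formulas apply directly.\<close>

lemma sl_eqI:
  fixes X Y :: "'a::comm_ring_1^(('k::finite + 'l::finite) option)^(('k + 'l) option)"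
  assumes sl: "X \<in> sl" "Y \<in> sl"
    and eq: "\<And>i k. X $ i $ Some (Inl k) = Y $ i $ Some (Inl k)"
      "\<And>i k. X $ i $ Some (Inr k) = Y $ i $ Some (Inr k)"
      "\<And>k. X $ Some (Inl k) $ None = Y $ Some (Inl k) $ None"
      "\<And>k. X $ Some (Inr k) $ None = Y $ Some (Inr k) $ None"
  shows "X = Y"
proof -
  have *: "X $ i $ Some a = Y $ i $ Some a" for i a
    using eq by (cases a) auto
  have "X $ None $ None = Y $ None $ None"
    using sl by (simp add: sl_iff *)
  then have "X $ i $ None = Y $ i $ None" for i
    using eq by (cases i; cases "the i") auto
  then have "X $ i $ j = Y $ i $ j" for i j
    using * by (cases j) auto
  then show ?thesis by (simp add: vec_eq_iff)
qed

lemma sl_add: "X \<in> sl \<Longrightarrow> Y \<in> sl \<Longrightarrow> X + Y \<in> sl"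
  and sl_diff: "X \<in> sl \<Longrightarrow> Y \<in> sl \<Longrightarrow> X - Y \<in> sl"
  and sl_uminus: "X \<in> sl \<Longrightarrow> - X \<in> sl"
  and sl_zero: "0 \<in> sl"
  for X Y :: "'a::comm_ring_1^'k^'k"
  by (simp_all add: sl_def trace_def sum.distrib sum_subtractf sum_negf)

lemma sl_scaleR: "X \<in> sl \<Longrightarrow> r *\<^sub>R X \<in> sl" for X :: "complex^'k^'k"
  by (simp add: sl_def trace_def scaleR_sum_right[symmetric])

lemma lie_bracket_in_sl: "lie_bracket X Y \<in> sl"
  by (simp add: lie_bracket_def sl_def trace_sub trace_mul_sym[of Y X])

lemma mult_If:
  "x * (if b then y else 0) = (if b then x * y else 0)"
  "(if b then y else 0) * x = (if b then y * x else 0)"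
  for x y :: "'a::mult_zero"
  by simp_all

text \<open>As \<open>J0\<close> is antisymmetric, the transpose of \<open>-J0 v\<close> is
  \<open>v^t J0\<close>. The last row thus transforms like the rows of \<open>A\<close>, by right
  multiplication with \<open>J0\<close>, and one formula serves every row \<open>i\<close>.\<close>

lemma J1_nth:
  shows "J1 Z $ i $ Some (Inl k) = Z $ i $ Some (Inr k)"
    and "J1 Z $ i $ Some (Inr k) = - Z $ i $ Some (Inl k)"
    and "J1 Z $ Some (Inl k) $ None = Z $ Some (Inr k) $ None"
    and "J1 Z $ Some (Inr k) $ None = - Z $ Some (Inl k) $ None"
  by (auto simp: J1_def J_sl_def triple_def cmat_def part_A_def part_v_def part_w_def Re_mat_def
      Im_mat_def J0_def matrix_matrix_mult_def matrix_vector_mult_def complex_eq_iff sum_UNIV_sum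
      mult_If split: option.split)

text \<open>The difference of the two projections is \<open>E\<close>, so \<open>J2\<close> is
  \<open>i\<close> times the complex extension of \<open>E\<close>. Off the corner it is diagonal in
  the matrix entries, with eigenvalues \<open>i\<close> and \<open>-i\<close>.\<close>

lemma J2_nth:
  shows "J2 Z $ i $ Some (Inl k) = \<i> * Z $ i $ Some (Inl k)"
    and "J2 Z $ i $ Some (Inr k) = - \<i> * Z $ i $ Some (Inr k)"
    and "J2 Z $ Some (Inl k) $ None = - \<i> * Z $ Some (Inl k) $ None"
    and "J2 Z $ Some (Inr k) $ None = \<i> * Z $ Some (Inr k) $ None"
  by (auto simp: J2_def i_times_def proj_plus_def proj_minus_def E_sl_def triple_def cmat_def
      part_A_def part_v_def part_w_def Re_mat_def Im_mat_def E0_def matrix_matrix_mult_def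
      matrix_vector_mult_def complex_eq_iff sum_UNIV_sum mult_If split: option.split)

section \<open>Invariance of \<open>sl\<close> and the quaternionic relations\<close>

lemma cmat_in_sl: "x \<in> sl \<Longrightarrow> y \<in> sl \<Longrightarrow> cmat x y \<in> sl"
  by (simp add: sl_def trace_def cmat_def complex_eq_iff)

lemma Re_Im_mat_in_sl: "Z \<in> sl \<Longrightarrow> Re_mat Z \<in> sl" "Z \<in> sl \<Longrightarrow> Im_mat Z \<in> sl"
  by (simp_all add: sl_def trace_def Re_mat_def Im_mat_def flip: Re_sum Im_sum)

lemma J1_in_sl: "J1 Z \<in> sl"
  by (simp add: J1_def J_sl_def cmat_in_sl triple_in_sl)

lemma i_times_in_sl: "Z \<in> sl \<Longrightarrow> i_times Z \<in> sl"
  by (simp add: sl_def trace_def i_times_def flip: sum_distrib_left)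

lemma sl_scaleR_real: "X \<in> sl \<Longrightarrow> r *\<^sub>R X \<in> sl" for X :: "real^'k^'k"
  by (simp add: sl_def trace_def flip: sum_distrib_left)

lemma J2_in_sl: "Z \<in> sl \<Longrightarrow> J2 Z \<in> sl"
  unfolding J2_def proj_plus_def proj_minus_def E_sl_def
  by (intro sl_diff i_times_in_sl cmat_in_sl sl_scaleR_real sl_add triple_in_sl Re_Im_mat_in_sl)

lemma J1_diff: "J1 (X - Y) = J1 X - J1 Y"
  and J1_uminus: "J1 (- X) = - J1 X"
  by (rule sl_eqI; simp add: J1_in_sl sl_diff sl_uminus J1_nth)+

lemma J1_J1: "Z \<in> sl \<Longrightarrow> J1 (J1 Z) = - Z"
  by (rule sl_eqI; simp add: J1_in_sl sl_uminus J1_nth)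

lemma J2_diff: "X \<in> sl \<Longrightarrow> Y \<in> sl \<Longrightarrow> J2 (X - Y) = J2 X - J2 Y"
  by (rule sl_eqI; simp add: J2_in_sl sl_diff J2_nth algebra_simps)

lemma J2_uminus: "X \<in> sl \<Longrightarrow> J2 (- X) = - J2 X"
  by (rule sl_eqI; simp add: J2_in_sl sl_uminus J2_nth)

lemma J2_J2: "Z \<in> sl \<Longrightarrow> J2 (J2 Z) = - Z"
  by (rule sl_eqI; simp add: J2_in_sl sl_uminus J2_nth algebra_simps)

lemma J2_J1: "Z \<in> sl \<Longrightarrow> J2 (J1 Z) = - J1 (J2 Z)"
  by (rule sl_eqI; simp add: J1_in_sl J2_in_sl sl_uminus J1_nth J2_nth)

section \<open>The Obata connection\<close>

definition obata :: "(complex, 'n::finite) mat_odd \<Rightarrow> (complex, 'n) mat_odd \<Rightarrow> (complex, 'n) mat_odd" where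
  "obata x y = (1/2) *\<^sub>R (lie_bracket x y + J1 (lie_bracket (J1 x) y)
     - J2 (lie_bracket x (J2 y)) + J3 (lie_bracket (J1 x) (J2 y)))"

text \<open>Torsion-freeness expands each bracket, and parallelism moves the complex structures out
  of the second argument. The terms in \<open>\<Gamma> g y x\<close>,
  \<open>J1 (\<Gamma> g (J1 x) y)\<close> and \<open>J2 (\<Gamma> g (J2 y) x)\<close> cancel in
  pairs, and two copies of \<open>\<Gamma> g x y\<close> remain.\<close>

lemma obata_connection_eq:
  assumes \<Gamma>: "obata_connection \<Gamma>" and "g \<in> SL" and x: "x \<in> sl" and y: "y \<in> sl"
  shows "\<Gamma> g x y = obata x y"
proof -
  have sl: "\<Gamma> g u v \<in> sl" if "u \<in> sl" "v \<in> sl" for u v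
    using \<Gamma> \<open>g \<in> SL\<close> that by (simp add: obata_connection_def affine_connection_def)
  have br: "lie_bracket u v = \<Gamma> g u v - \<Gamma> g v u" if "u \<in> sl" "v \<in> sl" for u v
    using \<Gamma> \<open>g \<in> SL\<close> that by (simp add: obata_connection_def torsion_free_def)
  have J1: "\<Gamma> g u (J1 v) = J1 (\<Gamma> g u v)" and J2: "\<Gamma> g u (J2 v) = J2 (\<Gamma> g u v)"
    if "u \<in> sl" "v \<in> sl" for u v
    using \<Gamma> \<open>g \<in> SL\<close> that by (simp_all add: obata_connection_def parallel_endo_def)
  have "lie_bracket x y + J1 (lie_bracket (J1 x) y)
     - J2 (lie_bracket x (J2 y)) + J3 (lie_bracket (J1 x) (J2 y)) = 2 *\<^sub>R \<Gamma> g x y"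
    using x y
    by (simp add: br J1 J2 sl J1_in_sl J2_in_sl J3_def J1_diff J2_diff J1_uminus J2_uminus
        J1_J1 J2_J2 J2_J1 scaleR_2)
  then show ?thesis by (simp add: obata_def)
qed

section \<open>Matrix units and the covariant derivatives along e, f and h\<close>

definition eunit :: "'m \<Rightarrow> 'm \<Rightarrow> 'a::comm_ring_1^'m^'m" where
  "eunit a b = (\<chi> i j. if i = a \<and> j = b then 1 else 0)"

lemma eunit_in_sl: "a \<noteq> b \<Longrightarrow> eunit a b \<in> sl"
  by (auto simp: sl_def trace_def eunit_def intro!: sum.neutral)

lemma lie_bracket_uminus: "lie_bracket (- x) y = - lie_bracket x y"
  by (simp add: vec_eq_iff lie_bracket_def matrix_matrix_mult_def sum_negf)

lemma eunit_mult_nth: "(eunit a b ** y) $ i $ j = (if i = a then y $ b $ j else 0)"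
  and mult_eunit_nth: "(y ** eunit a b) $ i $ j = (if j = b then y $ i $ a else 0)"
  by (auto simp: eunit_def matrix_matrix_mult_def mult_If)

text \<open>\<open>sl_mat f\<close> has the entries \<open>f\<close> off the last corner, which is then forced by the trace.\<close>

definition sl_mat :: "('k::finite option \<Rightarrow> 'k option \<Rightarrow> 'a::comm_ring_1) \<Rightarrow> 'a^('k option)^('k option)" where
  "sl_mat f = (\<chi> i j. if i = None \<and> j = None then - (\<Sum>a\<in>UNIV. f (Some a) (Some a)) else f i j)"

lemma sl_mat_nth [simp]:
  "sl_mat f $ Some a $ j = f (Some a) j"
  "sl_mat f $ i $ Some b = f i (Some b)"
  by (simp_all add: sl_mat_def)

lemma sl_mat_None: "sl_mat f $ None $ None = - (\<Sum>a\<in>UNIV. f (Some a) (Some a))"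
  by (simp add: sl_mat_def)

lemma sl_mat_in_sl [simp]: "sl_mat f \<in> sl"
  by (simp add: sl_iff sl_mat_None)

abbreviation (input) inl :: "'n \<Rightarrow> ('n + 'n) option" where "inl k \<equiv> Some (Inl k)"
abbreviation (input) inr :: "'n \<Rightarrow> ('n + 'n) option" where "inr k \<equiv> Some (Inr k)"

definition hvec :: "'n \<Rightarrow> ('n + 'n) option \<Rightarrow> real" where
  "hvec l i = (if i = inl l then 1 else if i = None then - 1 else 0)"

definition hmat :: "'n \<Rightarrow> (complex, 'n::finite) mat_odd" where
  "hmat l = (\<chi> i j. if i = j then of_real (hvec l i) else 0)"

lemma hvec_simps [simp]: "hvec l None = - 1" "hvec l (Some a) = (if a = Inl l then 1 else 0)"
  by (simp_all add: hvec_def)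

lemma hmat_in_sl: "hmat l \<in> sl"
  by (simp add: sl_iff hmat_def sum_UNIV_sum if_distrib[where f = of_real] cong: if_cong)

text \<open>These values enter the brackets with \<open>J1 x\<close> in \<open>obata\<close>. The
  corner entry of \<open>h\<close> is not seen by \<open>J1\<close>, so only its entry at
  \<open>l\<close> survives.\<close>

lemma J1_eunit:
  "J1 (eunit (inl l) None) = - eunit (inr l) None"
  "J1 (eunit None (inl l)) = - eunit None (inr l)"
  "J1 (hmat l) = - eunit (inl l) (inr l)"
  by (rule sl_eqI; simp add: J1_in_sl sl_uminus eunit_in_sl J1_nth;
      simp add: eunit_def hmat_def hvec_def)+

lemma hmat_mult_nth: "(hmat l ** y) $ i $ j = of_real (hvec l i) * y $ i $ j"
  and mult_hmat_nth: "(y ** hmat l) $ i $ j = of_real (hvec l j) * y $ i $ j"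
  by (simp_all add: hmat_def matrix_matrix_mult_def mult_If)

text \<open>The operator \<open>\<nabla>_e\<close>. On the columns other than the last it is left
  multiplication by \<open>e\<close>; the last column, on which \<open>J1\<close> and
  \<open>J2\<close> act differently, has its own rule. The value at the corner is a dummy that
  \<open>sl_mat\<close> overwrites.\<close>

definition De :: "'n \<Rightarrow> (complex, 'n::finite) mat_odd \<Rightarrow> (complex, 'n) mat_odd" where
  "De l y = sl_mat (\<lambda>i j. case j of
      Some b \<Rightarrow> if i = inl l then y $ None $ j else 0
    | None \<Rightarrow> (case i of Some (Inl k) \<Rightarrow> y $ inr k $ inr l | Some (Inr k) \<Rightarrow> - y $ inr k $ inl l
         | None \<Rightarrow> 0))"

definition Df :: "'n \<Rightarrow> (complex, 'n::finite) mat_odd \<Rightarrow> (complex, 'n) mat_odd" where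
  "Df l y = sl_mat (\<lambda>i j. if i = None \<and> j \<noteq> None then y $ inl l $ j else 0)"

text \<open>The eigenvalues of \<open>\<nabla>_h\<close> on the matrix entries. The value
  \<open>0\<close> at the corner, which is not a coordinate of \<open>sl\<close>, lets sums and
  products run over all index pairs.\<close>

definition hweight :: "'n \<Rightarrow> ('n + 'n) option \<Rightarrow> ('n + 'n) option \<Rightarrow> real" where
  "hweight l i j = (case j of Some _ \<Rightarrow> hvec l i
    | None \<Rightarrow> (case i of Some (Inl k) \<Rightarrow> if k = l then 2 else 1
    | Some (Inr k) \<Rightarrow> if k = l then 2 else 1 | None \<Rightarrow> 0))"

definition Dh :: "'n \<Rightarrow> (complex, 'n::finite) mat_odd \<Rightarrow> (complex, 'n) mat_odd" where
  "Dh l y = sl_mat (\<lambda>i j. hweight l i j *\<^sub>R y $ i $ j)"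

lemma obata_in_sl: "obata x y \<in> sl"
  unfolding obata_def
  by (intro sl_scaleR sl_add sl_diff J1_in_sl J2_in_sl lie_bracket_in_sl) (simp add: J3_def J1_in_sl)

text \<open>By \<open>sl_eqI\<close> only entries off the corner are compared. There
  \<open>J1\<close> and \<open>J2\<close> permute or scale entries, and brackets with matrix units
  pick out single rows and columns.\<close>

lemma obata_e: "obata (eunit (inl l) None) y = De l y"
  apply (rule sl_eqI)
  apply (simp_all add: obata_in_sl De_def)
  apply (simp_all add: obata_def J3_def J1_nth J2_nth J1_eunit lie_bracket_uminus)
  apply (auto simp: lie_bracket_def eunit_mult_nth mult_eunit_nth J1_nth J2_nth field_simps)
  done

lemma obata_f: "obata (eunit None (inl l)) y = Df l y"
  apply (rule sl_eqI)
  apply (simp_all add: obata_in_sl Df_def)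
  apply (simp_all add: obata_def J3_def J1_nth J2_nth J1_eunit lie_bracket_uminus)
  apply (auto simp: lie_bracket_def eunit_mult_nth mult_eunit_nth J1_nth J2_nth field_simps)
  done

lemma obata_h: "obata (hmat l) y = Dh l y"
  apply (rule sl_eqI)
  apply (simp_all add: obata_in_sl Dh_def)
  apply (simp_all add: obata_def J3_def J1_nth J2_nth J1_eunit lie_bracket_uminus)
  apply (auto simp: lie_bracket_def hmat_mult_nth mult_hmat_nth eunit_mult_nth mult_eunit_nth J1_nth
      J2_nth field_simps hweight_def hvec_def scaleR_conv_of_real)
  done

section \<open>The real determinant on the group of the tangent space\<close>

lemma sl_mat_self: "X \<in> sl \<Longrightarrow> sl_mat (\<lambda>i j. X $ i $ j) = X"
  by (auto simp: sl_mat_def vec_eq_iff sl_iff)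

lemma sl_mat_cong:
  assumes "\<And>i j. (i, j) \<noteq> (None, None) \<Longrightarrow> f i j = g i j"
  shows "sl_mat f = sl_mat g"
  using assms by (simp add: sl_mat_def vec_eq_iff)

type_synonym 'k coords = "real^(('k option \<times> 'k option) \<times> bool)"

definition of_coords :: "'k coords \<Rightarrow> complex^('k::finite option)^('k option)" where
  "of_coords v = sl_mat (\<lambda>i j. Complex (v $ ((i, j), True)) (v $ ((i, j), False)))"

definition entry :: "(('k::finite option \<times> 'k option) \<times> bool) \<Rightarrow> complex^('k option)^('k option) \<Rightarrow> real" where
  "entry q X = (if snd q then Re else Im) (X $ fst (fst q) $ snd (fst q))"

text \<open>The corner, which is not a coordinate of \<open>sl\<close>, is left fixed; this does not change the
  determinant and keeps the index type a plain product.\<close>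

definition coord_map ::
  "(complex^('k::finite option)^('k option) \<Rightarrow> complex^('k option)^('k option)) \<Rightarrow> 'k coords \<Rightarrow> 'k coords"
  where "coord_map f v = (\<chi> q. if fst q = (None, None) then v $ q else entry q (f (of_coords v)))"

definition det_sl ::
  "(complex^('k::finite option)^('k option) \<Rightarrow> complex^('k option)^('k option)) \<Rightarrow> real"
  where "det_sl f = det (matrix (coord_map f))"

lemma of_coords_in_sl [simp]: "of_coords v \<in> sl"
  by (simp add: of_coords_def)

text \<open>The corner coordinates of \<open>v\<close> are left free because
  \<open>of_coords\<close> discards them.\<close>

lemma of_coords_entries:
  assumes "X \<in> sl" and "\<And>q. fst q \<noteq> (None, None) \<Longrightarrow> v $ q = entry q X"
  shows "of_coords v = X"
proof -
  have "of_coords v = sl_mat (\<lambda>i j. X $ i $ j)"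
    unfolding of_coords_def
    by (rule sl_mat_cong) (simp add: assms entry_def)
  then show ?thesis using assms by (simp add: sl_mat_self)
qed

lemma entry_of_coords: "fst q \<noteq> (None, None) \<Longrightarrow> entry q (of_coords v) = v $ q"
  by (cases q; cases "fst q"; cases "snd q") (auto simp: entry_def of_coords_def sl_mat_def)

lemma entry_add: "entry q (X + Y) = entry q X + entry q Y"
  and entry_scaleR: "entry q (r *\<^sub>R X) = r * entry q X"
  by (simp_all add: entry_def)

lemma of_coords_add: "of_coords (v + w) = of_coords v + of_coords w"
  and of_coords_scaleR: "of_coords (r *\<^sub>R v) = r *\<^sub>R of_coords v"
  by (rule of_coords_entries; auto simp: sl_add sl_scaleR entry_of_coords[symmetric] entry_def)+

lemma linear_coord_map:
  assumes "real_linear_on sl f"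
  shows "linear (coord_map f)"
  using assms
  by (intro linearI) (auto simp: real_linear_on_def coord_map_def of_coords_add of_coords_scaleR
      vec_eq_iff entry_def)

lemma det_sl_cong: "(\<And>x. x \<in> sl \<Longrightarrow> f x = g x) \<Longrightarrow> det_sl f = det_sl g"
  by (auto simp: det_sl_def coord_map_def intro!: ext arg_cong[where f = "\<lambda>f. det (matrix f)"])

lemma det_sl_id: "det_sl (\<lambda>x :: complex^('k::finite option)^('k option). x) = 1"
proof -
  have "coord_map (\<lambda>x. x) = (id :: 'k coords \<Rightarrow> _)"
    by (auto simp: fun_eq_iff coord_map_def vec_eq_iff entry_of_coords)
  then show ?thesis by (simp add: det_sl_def matrix_id_mat_1)
qed

text \<open>\<open>coord_map\<close> respects composition, also on the corner coordinates, where
  both factors are the identity.\<close>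

lemma det_sl_compose:
  assumes "real_linear_on sl f" "real_linear_on sl g" "\<And>x. x \<in> sl \<Longrightarrow> g x \<in> sl"
  shows "det_sl (\<lambda>x. f (g x)) = det_sl f * det_sl g"
proof -
  have *: "of_coords (coord_map g v) = g (of_coords v)" for v
    by (rule of_coords_entries) (auto simp: assms coord_map_def)
  have "coord_map (\<lambda>x. f (g x)) v = coord_map f (coord_map g v)" for v
    unfolding coord_map_def[of f] * by (simp add: coord_map_def vec_eq_iff)
  then have "coord_map (\<lambda>x. f (g x)) = coord_map f \<circ> coord_map g"
    by (simp add: fun_eq_iff)
  then show ?thesis
    by (simp add: det_sl_def matrix_compose linear_coord_map assms det_mul)
qed

section \<open>Real linear bijections of \<open>sl\<close> and their commutators\<close>

definition linear_bij :: "(complex^'m^'m \<Rightarrow> complex^'m^'m) set" where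
  "linear_bij = {f \<in> carrier (BijGroup sl). real_linear_on sl f}"

lemma linear_bij_maps: "f \<in> linear_bij \<Longrightarrow> x \<in> sl \<Longrightarrow> f x \<in> sl"
  by (auto simp: linear_bij_def BijGroup_def dest: Bij_imp_funcset)

text \<open>The product of \<open>BijGroup\<close> agrees with composition on \<open>sl\<close>,
  which is all that \<open>det_sl\<close> sees.\<close>

lemma linear_bij_mult:
  fixes f g :: "complex^('k::finite option)^('k option) \<Rightarrow> complex^('k option)^('k option)"
  assumes "f \<in> linear_bij" "g \<in> linear_bij"
  shows "f \<otimes>\<^bsub>BijGroup sl\<^esub> g \<in> linear_bij \<and> det_sl (f \<otimes>\<^bsub>BijGroup sl\<^esub> g) = det_sl f * det_sl g"
proof -
  interpret group "BijGroup (sl :: (complex^('k option)^('k option)) set)" by (rule group_BijGroup)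
  have eq: "(f \<otimes>\<^bsub>BijGroup sl\<^esub> g) x = f (g x)" if "x \<in> sl" for x
    using assms that by (simp add: linear_bij_def BijGroup_def compose_def)
  have "real_linear_on sl (f \<otimes>\<^bsub>BijGroup sl\<^esub> g)"
    using assms linear_bij_maps[OF assms(2)]
    by (auto simp: linear_bij_def real_linear_on_def eq sl_add sl_scaleR)
  moreover have "det_sl (f \<otimes>\<^bsub>BijGroup sl\<^esub> g) = det_sl (\<lambda>x. f (g x))"
    by (rule det_sl_cong) (rule eq)
  ultimately show ?thesis
    using assms det_sl_compose[of f g] linear_bij_maps[OF assms(2)] m_closed
    by (auto simp: linear_bij_def)
qed

lemma det_sl_one:
  "det_sl (\<one>\<^bsub>BijGroup sl\<^esub> :: complex^('k::finite option)^('k option) \<Rightarrow> _) = 1"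
proof -
  have "det_sl (\<one>\<^bsub>BijGroup sl\<^esub> :: complex^('k option)^('k option) \<Rightarrow> _)
      = det_sl (\<lambda>x :: complex^('k option)^('k option). x)"
    by (rule det_sl_cong) (simp add: BijGroup_def)
  then show ?thesis by (simp add: det_sl_id)
qed

text \<open>Linearity of the inverse follows from that of \<open>f\<close> by injectivity on
  \<open>sl\<close>; the determinant relation is \<open>det_sl\<close> applied to the group
  law.\<close>

lemma linear_bij_inv:
  fixes f :: "complex^('k::finite option)^('k option) \<Rightarrow> complex^('k option)^('k option)"
  assumes "f \<in> linear_bij"
  shows "inv\<^bsub>BijGroup sl\<^esub> f \<in> linear_bij \<and> det_sl (inv\<^bsub>BijGroup sl\<^esub> f) * det_sl f = 1"
proof -
  let ?G = "BijGroup (sl :: (complex^('k option)^('k option)) set)"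
  interpret group ?G by (rule group_BijGroup)
  have f: "f \<in> Bij sl" "real_linear_on sl f"
    using assms by (auto simp: linear_bij_def BijGroup_def)
  have eq: "(inv\<^bsub>?G\<^esub> f) x = inv_into sl f x" if "x \<in> sl" for x
    using f that by (simp add: inv_BijGroup)
  have inv: "f (inv_into sl f x) = x" "inv_into sl f x \<in> sl" if "x \<in> sl" for x
    using f that by (auto simp: Bij_def bij_betw_def f_inv_into_f inv_into_into)
  have inj: "inj_on f sl" using f by (simp add: Bij_def bij_betw_def)
  have "inv_into sl f (x + y) = inv_into sl f x + inv_into sl f y" if "x \<in> sl" "y \<in> sl" for x y
    by (rule inj_onD[OF inj]) (use f that in \<open>auto simp: inv sl_add real_linear_on_def\<close>)
  moreover have "inv_into sl f (r *\<^sub>R x) = r *\<^sub>R inv_into sl f x" if "x \<in> sl" for x r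
    by (rule inj_onD[OF inj]) (use f that in \<open>auto simp: inv sl_scaleR real_linear_on_def\<close>)
  ultimately have mem: "inv\<^bsub>?G\<^esub> f \<in> linear_bij"
    using assms by (auto simp: linear_bij_def real_linear_on_def eq sl_add sl_scaleR)
  have "inv\<^bsub>?G\<^esub> f \<otimes>\<^bsub>?G\<^esub> f = \<one>\<^bsub>?G\<^esub>"
    using assms by (simp add: linear_bij_def)
  with mem linear_bij_mult[OF mem assms] show ?thesis by (simp add: det_sl_one)
qed

text \<open>Real numbers commute, so commutators have determinant \<open>1\<close>, and this passes
  to the subgroup they generate. Membership in \<open>linear_bij\<close> is carried through the
  induction because multiplicativity of \<open>det_sl\<close> is stated there.\<close>

lemma SL_H_det_sl:
  fixes f :: "(complex, 'n::finite) mat_odd \<Rightarrow> (complex, 'n) mat_odd"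
  assumes "f \<in> SL_H"
  shows "det_sl f = 1"
proof -
  let ?G = "BijGroup (sl :: (complex, 'n) mat_odd set)"
  interpret group ?G by (rule group_BijGroup)
  have GL: "GL_H \<subseteq> linear_bij"
    by (auto simp: GL_H_def linear_bij_def)
  have comm: "h \<in> linear_bij \<and> det_sl h = 1" if h: "h \<in> derived_set ?G GL_H" for h
  proof -
    obtain a b where "a \<in> GL_H" "b \<in> GL_H"
      and h_eq: "h = a \<otimes>\<^bsub>?G\<^esub> b \<otimes>\<^bsub>?G\<^esub> inv\<^bsub>?G\<^esub> a \<otimes>\<^bsub>?G\<^esub> inv\<^bsub>?G\<^esub> b"
      using h by blast
    then have ab: "a \<in> linear_bij" "b \<in> linear_bij"
      using GL by auto
    have "h \<in> linear_bij"
      and "det_sl h = det_sl a * det_sl b * det_sl (inv\<^bsub>?G\<^esub> a) * det_sl (inv\<^bsub>?G\<^esub> b)"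
      unfolding h_eq by (simp_all add: ab linear_bij_mult linear_bij_inv)
    moreover from this(2) have
      "det_sl h = (det_sl (inv\<^bsub>?G\<^esub> a) * det_sl a) * (det_sl (inv\<^bsub>?G\<^esub> b) * det_sl b)"
      by (simp only: mult_ac)
    ultimately show ?thesis
      using linear_bij_inv[OF ab(1)] linear_bij_inv[OF ab(2)] by simp
  qed
  have "f \<in> generate ?G (derived_set ?G GL_H)"
    using assms by (simp add: SL_H_def derived_def)
  then have "f \<in> linear_bij \<and> det_sl f = 1"
  proof (induction rule: generate.induct)
    case one
    have "real_linear_on sl (\<one>\<^bsub>?G\<^esub>)"
      by (simp add: real_linear_on_def BijGroup_def sl_add sl_scaleR)
    then show ?case by (simp add: linear_bij_def det_sl_one)
  next
    case (incl h)
    then show ?case by (rule comm)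
  next
    case (inv h)
    from comm[OF this] linear_bij_inv[of h] show ?case by simp
  next
    case (eng h1 h2)
    then show ?case using linear_bij_mult[of h1 h2] by simp
  qed
  then show ?thesis by simp
qed

text \<open>In coordinates the map becomes \<open>1 + tG\<close>, where \<open>G\<close> is
  \<open>D\<close> extended by zero on the corner and inherits square zero from it.\<close>

lemma det_sl_unipotent:
  fixes D :: "complex^('k::finite option)^('k option) \<Rightarrow> complex^('k option)^('k option)"
  assumes D: "real_linear_on sl D" "\<And>x. x \<in> sl \<Longrightarrow> D x \<in> sl" "\<And>x. x \<in> sl \<Longrightarrow> D (D x) = 0"
  shows "det_sl (\<lambda>x. x + t *\<^sub>R D x) = 1"
proof -
  define G where "G v = (\<chi> q. if fst q = (None, None) then 0 else entry q (D (of_coords v)))"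
    for v :: "'k coords"
  have lin: "linear G"
    using D(1) by (intro linearI) (auto simp: G_def real_linear_on_def of_coords_add of_coords_scaleR
      vec_eq_iff entry_def)
  have T: "of_coords (G v) = D (of_coords v)" for v
    by (rule of_coords_entries) (auto simp: D G_def)
  have "G (G v) = 0" for v
    unfolding G_def[of "G v"] T by (simp add: D vec_eq_iff entry_def)
  then have "G \<circ> G = (\<lambda>v. 0)"
    by (simp add: fun_eq_iff)
  then have N: "matrix G ** matrix G = 0"
    using matrix_compose[OF lin lin] by (simp add: matrix_def vec_eq_iff)
  have "coord_map (\<lambda>x. x + t *\<^sub>R D x) v = v + t *\<^sub>R G v" for v
    by (auto simp: coord_map_def G_def vec_eq_iff entry_add entry_scaleR entry_of_coords)
  then have "matrix (coord_map (\<lambda>x. x + t *\<^sub>R D x)) =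
      (\<chi> i j. (if i = j then 1 else 0) + t * matrix G $ i $ j)"
    by (simp add: matrix_def vec_eq_iff axis_def)
  then show ?thesis
    using det_mat_1_plus_nilpotent[OF N] by (simp add: det_sl_def)
qed

text \<open>Each complex entry accounts for two real coordinates, whence the squares.\<close>

lemma det_sl_diagonal:
  "det_sl (\<lambda>x. sl_mat (\<lambda>i j. d i j *\<^sub>R x $ i $ j)) =
     (\<Prod>q\<in>UNIV. if q = (None, None) then 1 else (d (fst q) (snd q))\<^sup>2)"
proof -
  define c where "c q = (if q = (None, None) then 1 else d (fst q) (snd q))" for q
  have "coord_map (\<lambda>x. sl_mat (\<lambda>i j. d i j *\<^sub>R x $ i $ j)) v $ q = c (fst q) * v $ q" for v q
    using entry_of_coords[of q v]
    by (cases q; cases "fst q") (auto simp: coord_map_def entry_def sl_mat_def c_def)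
  then have m: "matrix (coord_map (\<lambda>x. sl_mat (\<lambda>i j. d i j *\<^sub>R x $ i $ j))) $ q $ r =
      (if q = r then c (fst q) else 0)" for q r
    by (simp add: matrix_def axis_def)
  have "det_sl (\<lambda>x. sl_mat (\<lambda>i j. d i j *\<^sub>R x $ i $ j)) = (\<Prod>q\<in>(UNIV :: (_ \<times> bool) set). c (fst q))"
    unfolding det_sl_def by (subst det_diagonal) (auto simp: m)
  also have "\<dots> = (\<Prod>(q, b)\<in>UNIV \<times> (UNIV :: bool set). c q)"
    by (simp add: case_prod_unfold)
  also have "\<dots> = (\<Prod>q\<in>UNIV. (c q)\<^sup>2)"
    by (subst prod.cartesian_product[symmetric]) (simp add: UNIV_bool power2_eq_square)
  finally show ?thesis
    by (simp add: c_def if_distrib[where f = "\<lambda>x. x\<^sup>2"] cong: if_cong)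
qed

section \<open>Parallel transport along concatenated one-parameter curves\<close>

lemma has_vector_derivative_vecI:
  fixes f :: "real \<Rightarrow> 'b::real_normed_vector^'n"
  assumes "\<And>i. ((\<lambda>t. f t $ i) has_vector_derivative f' $ i) (at t within S)"
  shows "(f has_vector_derivative f') (at t within S)"
  using assms
  by (auto simp: has_vector_derivative_def has_derivative_within bounded_linear_scaleR_left
      intro!: vec_tendstoI)

lemma bounded_linear_mult_mat:
  "bounded_linear (\<lambda>Y. q ** Y ** Z)" for q Z :: "complex^'m^'m"
proof -
  have "q ** (r *\<^sub>R Y) ** Z = r *\<^sub>R (q ** Y ** Z)" for r Y
    by (simp add: vec_eq_iff matrix_matrix_mult_def scaleR_sum_right sum_distrib_right)
  moreover have "q ** (Y + Y') ** Z = q ** Y ** Z + q ** Y' ** Z" for Y Y'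
    by (simp add: vec_eq_iff matrix_matrix_mult_def algebra_simps sum.distrib sum_distrib_left sum_distrib_right)
  ultimately show ?thesis
    by (intro linear_conv_bounded_linear[THEN iffD1] linearI)
qed

lemma has_vector_derivative_minus_arg:
  assumes "(f has_vector_derivative d) (at (t - a))"
  shows "((\<lambda>t. f (t - a)) has_vector_derivative d) (at t within S)"
proof -
  have "((\<lambda>t. t - a) has_vector_derivative 1) (at t within S)"
    by (auto intro!: derivative_eq_intros)
  from vector_diff_chain_within[OF this has_vector_derivative_at_within[OF assms]]
  show ?thesis by (simp add: o_def)
qed

text \<open>The constant right factor \<open>Z\<close> is there for iteration: with
  \<open>Z = X^k\<close>, each differentiation raises \<open>k\<close> by one, which yields the
  derivatives of all orders.\<close>

lemma shifted_curve_derivative: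
  fixes c :: "real \<Rightarrow> complex^'m^'m" and q Z :: "complex^'m^'m"
  assumes "\<And>t. (c has_vector_derivative c t ** X) (at t)"
  shows "((\<lambda>t. q ** c (t - a) ** Z) has_vector_derivative q ** c (t - a) ** (X ** Z)) (at t within S)"
proof -
  have "((\<lambda>t. c (t - a)) has_vector_derivative c (t - a) ** X) (at t within S)"
    by (rule has_vector_derivative_minus_arg[OF assms])
  from bounded_linear.has_vector_derivative[OF bounded_linear_mult_mat this, of q Z]
  show ?thesis by (simp add: matrix_mul_assoc)
qed

lemma smooth_shifted_curve:
  fixes c :: "real \<Rightarrow> complex^'m^'m" and q :: "complex^'m^'m"
  assumes "\<And>t. (c has_vector_derivative c t ** X) (at t)"
  shows "smooth_on_interval (\<lambda>t. q ** c (t - a)) u v"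
proof -
  let ?F = "\<lambda>k t. q ** c (t - a) ** (((**) X) ^^ k) (mat 1)"
  have "(?F k has_vector_derivative ?F (Suc k) t) (at t within S)" for k t S
    using shifted_curve_derivative[OF assms, of q a "(((**) X) ^^ k) (mat 1)"] by simp
  moreover have "?F 0 = (\<lambda>t. q ** c (t - a))" by simp
  ultimately show ?thesis
    unfolding smooth_on_interval_def by (intro exI[of _ ?F]) blast
qed

section \<open>Gluing of curves and of parallel transports\<close>

lemma has_vector_derivative_within_cong:
  assumes "\<And>s. s \<in> S \<Longrightarrow> f s = g s" "t \<in> S"
  shows "(f has_vector_derivative d) (at t within S) \<longleftrightarrow> (g has_vector_derivative d) (at t within S)"
proof
  show "(g has_vector_derivative d) (at t within S)" if "(f has_vector_derivative d) (at t within S)"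
    by (rule has_vector_derivative_transform[OF assms(2) assms(1)[symmetric] that])
  show "(f has_vector_derivative d) (at t within S)" if "(g has_vector_derivative d) (at t within S)"
    by (rule has_vector_derivative_transform[OF assms(2) assms(1) that])
qed

lemma smooth_on_interval_cong:
  assumes "\<And>t. t \<in> {a..b} \<Longrightarrow> f t = g t" "smooth_on_interval f a b"
  shows "smooth_on_interval g a b"
proof -
  obtain F where F: "F 0 = f"
    "\<And>k t. t \<in> {a..b} \<Longrightarrow> (F k has_vector_derivative F (Suc k) t) (at t within {a..b})"
    using assms(2) unfolding smooth_on_interval_def by (elim exE conjE) blast
  \<comment> \<open>The definition asks for \<open>F 0 = g\<close> as functions, also outside the
    interval, so the zeroth member is replaced while the higher derivatives stay.\<close>
  have "((F(0 := g)) k has_vector_derivative (F(0 := g)) (Suc k) t) (at t within {a..b})"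
    if "t \<in> {a..b}" for k t
    using F(2)[OF that, of k] has_vector_derivative_within_cong[of "{a..b}" f g t "F (Suc 0) t"]
      assms(1) that by (cases k) (auto simp: F(1))
  then show ?thesis
    unfolding smooth_on_interval_def by (intro exI[of _ "F(0 := g)"]) simp
qed

text \<open>A path that need not be closed, with its transport \<open>P\<close>. The breakpoints are
  the integers \<open>0, ..., k\<close>, so that appending a piece only raises \<open>k\<close> by
  one.\<close>

definition reaches ::
  "('m::finite) connection \<Rightarrow> complex^'m^'m \<Rightarrow> complex^'m^'m \<Rightarrow> (complex^'m^'m \<Rightarrow> complex^'m^'m) \<Rightarrow> bool" where
  "reaches \<Gamma> p q P \<longleftrightarrow> (\<exists>\<gamma> k.
     (\<forall>i<k. smooth_on_interval \<gamma> (real i) (real (Suc i))) \<and>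
     (\<forall>t\<in>{0..real k}. \<gamma> t \<in> SL) \<and> \<gamma> 0 = p \<and> \<gamma> (real k) = q \<and>
     (\<forall>u\<in>sl. \<exists>y. parallel_along \<Gamma> \<gamma> real k y \<and> y 0 = u \<and> y (real k) = P u))"

lemma reaches_refl: "p \<in> SL \<Longrightarrow> reaches \<Gamma> p p (\<lambda>u. u)"
  unfolding reaches_def parallel_along_def
  by (intro exI[of _ "\<lambda>_. p"] exI[of _ 0]) auto

lemma reaches_maps_sl:
  assumes "reaches \<Gamma> p q P" "u \<in> sl"
  shows "P u \<in> sl"
proof -
  obtain \<gamma> k y where "parallel_along \<Gamma> \<gamma> real k y" "y (real k) = P u"
    using assms unfolding reaches_def by blast
  then show ?thesis
    by (auto simp: parallel_along_def dest: bspec[of _ _ "real k"])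
qed

lemma reaches_end:
  assumes "reaches \<Gamma> p q P"
  shows "q \<in> SL"
proof -
  obtain \<gamma> k where "\<forall>t\<in>{0..real k}. \<gamma> t \<in> SL" "\<gamma> (real k) = q"
    using assms unfolding reaches_def by blast
  then show ?thesis by (auto dest: bspec[of _ _ "real k"])
qed

lemma reaches_holonomy:
  assumes "reaches \<Gamma> p p P"
  shows "restrict P sl \<in> holonomy_group \<Gamma> p"
proof -
  obtain \<gamma> k where *: "\<forall>i<k. smooth_on_interval \<gamma> (real i) (real (Suc i))"
     "\<forall>t\<in>{0..real k}. \<gamma> t \<in> SL" "\<gamma> 0 = p" "\<gamma> (real k) = p"
     and P: "\<And>u. u \<in> sl \<Longrightarrow> \<exists>y. parallel_along \<Gamma> \<gamma> real k y \<and> y 0 = u \<and> y (real k) = P u"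
    using assms unfolding reaches_def by blast
  have "piecewise_smooth_loop \<gamma> real k p"
    using * by (simp add: piecewise_smooth_loop_def)
  moreover have "\<exists>y. parallel_along \<Gamma> \<gamma> real k y \<and> y (real 0) = u \<and> restrict P sl u = y (real k)"
    if "u \<in> sl" for u
    using P[OF that] that by auto
  ultimately show ?thesis
    unfolding holonomy_group_def by blast
qed

lemma SL_matrix_inv:
  fixes g :: "complex^'m^'m"
  assumes "g \<in> SL"
  shows "matrix_inv g ** (g ** X) = X"
proof -
  have "invertible g" using assms by (simp add: SL_def invertible_det_nz)
  then have "matrix_inv g ** g = mat 1"
    unfolding invertible_def matrix_inv_def by (rule someI2_ex) simp
  then show ?thesis by (simp add: matrix_mul_assoc)
qed

lemma SL_mult: "g \<in> SL \<Longrightarrow> h \<in> SL \<Longrightarrow> g ** h \<in> SL" for g :: "complex^'m^'m"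
  by (simp add: SL_def det_mul)

text \<open>As \<open>c' = c X\<close>, the curve \<open>q c(t - k)\<close> has constant velocity
  \<open>X\<close> in the left trivialisation. The premise on \<open>Q\<close> holds at every
  \<open>g\<close>, so \<open>Q\<close> solves the transport equation along this piece wherever it
  starts.\<close>

lemma reaches_step:
  fixes c :: "real \<Rightarrow> complex^'m^'m"
  assumes r: "reaches \<Gamma> p q P"
    and c: "\<And>t. (c has_vector_derivative c t ** X) (at t)" "c 0 = mat 1" "\<And>t. c t \<in> SL"
    and Q: "\<And>t g u. g \<in> SL \<Longrightarrow> u \<in> sl \<Longrightarrow>
        ((\<lambda>t. Q t u) has_vector_derivative - \<Gamma> g X (Q t u)) (at t)"
      "\<And>u. u \<in> sl \<Longrightarrow> Q 0 u = u" "\<And>t u. u \<in> sl \<Longrightarrow> Q t u \<in> sl"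
  shows "reaches \<Gamma> p (q ** c 1) (\<lambda>u. Q 1 (P u))"
proof -
  obtain \<gamma> k where smooth: "\<And>i. i < k \<Longrightarrow> smooth_on_interval \<gamma> (real i) (real (Suc i))"
     and \<gamma>: "\<And>t. t \<in> {0..real k} \<Longrightarrow> \<gamma> t \<in> SL" "\<gamma> 0 = p" "\<gamma> (real k) = q"
     and P: "\<And>u. u \<in> sl \<Longrightarrow> \<exists>y. parallel_along \<Gamma> \<gamma> real k y \<and> y 0 = u \<and> y (real k) = P u"
    using r unfolding reaches_def by blast
  define \<gamma>' where "\<gamma>' t = (if t \<le> real k then \<gamma> t else q ** c (t - real k))" for t
  have old: "\<gamma>' t = \<gamma> t" if "t \<le> real k" for t
    using that by (simp add: \<gamma>'_def)
  \<comment> \<open>At the joint \<open>t = k\<close> both formulas apply because \<open>c 0\<close>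
    is the identity, so the new piece is available on a closed interval.\<close>
  have new: "\<gamma>' t = q ** c (t - real k)" if "t \<ge> real k" for t
    using that \<gamma>(3) c(2) by (auto simp: \<gamma>'_def)
  have q: "q \<in> SL" using r by (rule reaches_end)
  have "smooth_on_interval \<gamma>' (real i) (real (Suc i))" if "i < Suc k" for i
  proof (cases "i = k")
    case True
    show ?thesis
      by (rule smooth_on_interval_cong[OF _ smooth_shifted_curve[OF c(1), of q "real k"]])
        (use True in \<open>auto simp: new\<close>)
  next
    case False
    with that have "i < k" by simp
    then show ?thesis
      by (intro smooth_on_interval_cong[OF _ smooth]) (auto simp: old)
  qed
  moreover have SL': "\<gamma>' t \<in> SL" if "t \<ge> 0" for t
    using that \<gamma>(1) SL_mult[OF q c(3)] by (auto simp: \<gamma>'_def)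
  moreover have "\<exists>y. parallel_along \<Gamma> \<gamma>' real (Suc k) y \<and> y 0 = u \<and> y (real (Suc k)) = Q 1 (P u)"
    if u: "u \<in> sl" for u
  proof -
    obtain y where y: "parallel_along \<Gamma> \<gamma> real k y" "y 0 = u" "y (real k) = P u"
      using P[OF u] by blast
    have Pu: "P u \<in> sl" by (rule reaches_maps_sl[OF r u])
    define z where "z t = (if t \<le> real k then y t else Q (t - real k) (P u))" for t
    have z_old: "z t = y t" if "t \<le> real k" for t
      using that by (simp add: z_def)
    \<comment> \<open>In the same way \<open>Q 0\<close> being the identity joins the two fields at
      \<open>t = k\<close>.\<close>
    have z_new: "z t = Q (t - real k) (P u)" if "t \<ge> real k" for t
      using that y(3) Q(2)[OF Pu] by (auto simp: z_def)
    have "(z has_vector_derivative - \<Gamma> (\<gamma>' t)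
          (matrix_inv (\<gamma>' t) ** vector_derivative \<gamma>' (at t within {real i..real (Suc i)})) (z t))
        (at t within {real i..real (Suc i)})"
      if i: "i < Suc k" and t: "t \<in> {real i..real (Suc i)}" for i t
    proof (cases "i = k")
      case True
      have ge: "s \<ge> real k" if "s \<in> {real i..real (Suc i)}" for s
        using that True by simp
      have "((\<lambda>t. q ** c (t - real k)) has_vector_derivative \<gamma>' t ** X)
          (at t within {real i..real (Suc i)})"
        using shifted_curve_derivative[OF c(1), of q "real k" "mat 1" t "{real i..real (Suc i)}"]
        by (simp add: new[OF ge[OF t]] matrix_mul_assoc)
      then have "(\<gamma>' has_vector_derivative \<gamma>' t ** X) (at t within {real i..real (Suc i)})"
        by (subst has_vector_derivative_within_cong[where g = "\<lambda>t. q ** c (t - real k)"])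
          (simp_all only: new ge t)
      \<comment> \<open>The inverse of \<open>\<gamma>' t\<close> will cancel against this velocity
        and leave \<open>X\<close> as the direction in \<open>\<Gamma>\<close>.\<close>
      then have "vector_derivative \<gamma>' (at t within {real i..real (Suc i)}) = \<gamma>' t ** X"
        by (intro vector_derivative_within_closed_interval t) simp
      moreover have "\<gamma>' t \<in> SL"
        by (rule SL'[OF order_trans[OF of_nat_0_le_iff ge[OF t]]])
      moreover have "((\<lambda>t. Q (t - real k) (P u)) has_vector_derivative
          - \<Gamma> (\<gamma>' t) X (Q (t - real k) (P u))) (at t within {real i..real (Suc i)})"
        by (rule has_vector_derivative_minus_arg[OF Q(1)[OF \<open>\<gamma>' t \<in> SL\<close> Pu]])
      then have "(z has_vector_derivative - \<Gamma> (\<gamma>' t) X (z t)) (at t within {real i..real (Suc i)})"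
        unfolding z_new[OF ge[OF t]]
        by (subst has_vector_derivative_within_cong[where g = "\<lambda>t. Q (t - real k) (P u)"])
          (simp_all only: z_new ge t)
      ultimately show ?thesis
        by (simp add: SL_matrix_inv)
    next
      case False
      with i have ik: "i < k" by simp
      then have le: "s \<le> real k" if "s \<in> {real i..real (Suc i)}" for s
        using that by auto
      have "vector_derivative \<gamma>' (at t within {real i..real (Suc i)}) =
          vector_derivative \<gamma> (at t within {real i..real (Suc i)})"
        unfolding vector_derivative_def
        by (subst has_vector_derivative_within_cong[where g = \<gamma>]) (simp_all only: old le t)
      moreover have "(y has_vector_derivative - \<Gamma> (\<gamma> t)
          (matrix_inv (\<gamma> t) ** vector_derivative \<gamma> (at t within {real i..real (Suc i)})) (y t))
        (at t within {real i..real (Suc i)})"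
        using y(1) ik t unfolding parallel_along_def by blast
      ultimately show ?thesis
        by (subst has_vector_derivative_within_cong[where g = y]) (simp_all only: z_old old le t)
    qed
    moreover have "z t \<in> sl" if "t \<in> {0..real (Suc k)}" for t
      using that y(1) Q(3)[OF Pu] by (auto simp: z_def parallel_along_def)
    ultimately have "parallel_along \<Gamma> \<gamma>' real (Suc k) z"
      unfolding parallel_along_def by simp
    moreover have "z 0 = u" "z (real (Suc k)) = Q 1 (P u)"
      using y by (simp_all add: z_old z_new)
    ultimately show ?thesis by blast
  qed
  moreover have "\<gamma>' 0 = p" "\<gamma>' (real (Suc k)) = q ** c 1"
    using \<gamma> by (simp_all add: old new)
  ultimately show ?thesis
    unfolding reaches_def by (intro exI[of _ \<gamma>'] exI[of _ "Suc k"]) simp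
qed

section \<open>The holonomy loop\<close>

definition unipotent :: "'m \<Rightarrow> 'm \<Rightarrow> complex \<Rightarrow> complex^'m^'m" where
  "unipotent a b s = (\<chi> i j. (if i = j then 1 else 0) + s * eunit a b $ i $ j)"

lemma mult_scaleR_nth: "(M ** (r *\<^sub>R X)) $ i $ j = r *\<^sub>R (M ** X) $ i $ j"
  for M X :: "complex^'m^'m"
  by (simp add: matrix_matrix_mult_def scaleR_sum_right)

text \<open>Right multiplication by a unipotent factor is a column operation; in this form the
  closing of the loop is checked entry by entry.\<close>

lemma mult_unipotent_nth:
  fixes M :: "complex^'m^'m"
  shows "(M ** unipotent a b s) $ i $ j = M $ i $ j + (if j = b then s * M $ i $ a else 0)"
proof -
  have "(M ** unipotent a b s) $ i $ j =
      (\<Sum>k\<in>UNIV. (if k = j then M $ i $ k else 0) + s * (M $ i $ k * eunit a b $ k $ j))"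
    unfolding matrix_matrix_mult_def unipotent_def by (auto simp: algebra_simps intro!: sum.cong)
  also have "\<dots> = M $ i $ j + s * (M ** eunit a b) $ i $ j"
    by (simp add: sum.distrib sum_distrib_left matrix_matrix_mult_def)
  finally show ?thesis by (simp add: mult_eunit_nth)
qed

lemma unipotent_in_SL: "a \<noteq> b \<Longrightarrow> unipotent a b s \<in> SL"
  unfolding SL_def unipotent_def mem_Collect_eq
  by (rule det_mat_1_plus_nilpotent) (auto simp: vec_eq_iff eunit_mult_nth, simp add: eunit_def)

text \<open>For \<open>a \<noteq> b\<close> the matrix unit has square zero, so this one-parameter
  group is affine in \<open>t\<close> and its velocity is constant.\<close>

lemma unipotent_derivative:
  assumes "a \<noteq> b"
  shows "((\<lambda>t. unipotent a b (of_real (t * r))) has_vector_derivative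
    unipotent a b (of_real (t * r)) ** (r *\<^sub>R eunit a b)) (at t)"
proof (intro has_vector_derivative_vecI)
  fix i j
  have "unipotent a b s ** (r *\<^sub>R eunit a b) = r *\<^sub>R eunit a b" for s
    using assms
    by (simp add: vec_eq_iff mult_scaleR_nth mult_eunit_nth) (simp add: unipotent_def eunit_def)
  then show "((\<lambda>t. unipotent a b (of_real (t * r)) $ i $ j) has_vector_derivative
      (unipotent a b (of_real (t * r)) ** (r *\<^sub>R eunit a b)) $ i $ j) (at t)"
    by (auto simp: unipotent_def scaleR_conv_of_real[where 'a = complex] intro!: derivative_eq_intros)
qed

definition torus :: "'n \<Rightarrow> real \<Rightarrow> (complex, 'n::finite) mat_odd" where
  "torus l s = (\<chi> i j. if i = j then of_real (exp (s * hvec l i)) else 0)"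

lemma sum_hvec: "(\<Sum>i\<in>UNIV. hvec l i) = 0" for l :: "'n::finite"
  by (simp add: sum_UNIV_option sum_UNIV_sum)

text \<open>The determinant is the exponential of \<open>s\<close> times the trace of
  \<open>h\<close>, which is zero.\<close>

lemma torus_in_SL: "torus l s \<in> SL"
proof -
  have "det (torus l s) = of_real (exp (s * (\<Sum>i\<in>UNIV. hvec l i)))"
    by (subst det_diagonal) (simp_all add: torus_def exp_sum sum_distrib_left)
  then show ?thesis by (simp add: SL_def sum_hvec)
qed

lemma mult_torus_nth: "(M ** torus l s) $ i $ j = exp (s * hvec l j) *\<^sub>R M $ i $ j"
  by (simp add: torus_def matrix_matrix_mult_def mult_If scaleR_conv_of_real[where 'a = complex])

lemma torus_derivative:
  fixes l :: "'n::finite"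
  shows "((\<lambda>t. torus l (t * r)) has_vector_derivative torus l (t * r) ** (r *\<^sub>R hmat l)) (at t)"
proof (intro has_vector_derivative_vecI)
  fix i j
  have "(M ** (r *\<^sub>R hmat l)) $ i $ j = of_real (r * hvec l j) * M $ i $ j"
    for M :: "(complex, 'n) mat_odd"
    by (simp add: mult_scaleR_nth mult_hmat_nth) (simp add: scaleR_conv_of_real[where 'a = complex])
  then show "((\<lambda>t. torus l (t * r) $ i $ j) has_vector_derivative
      (torus l (t * r) ** (r *\<^sub>R hmat l)) $ i $ j) (at t)"
    by (auto simp: torus_def scaleR_conv_of_real[where 'a = complex] intro!: derivative_eq_intros)
qed

section \<open>Transport along the pieces and its real determinant\<close>

lemma sl_mat_derivative:
  fixes f :: "real \<Rightarrow> 'k::finite option \<Rightarrow> 'k option \<Rightarrow> complex"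
  assumes "\<And>i j. ((\<lambda>t. f t i j) has_vector_derivative f' i j) (at t)"
  shows "((\<lambda>t. sl_mat (f t)) has_vector_derivative sl_mat f') (at t)"
  by (intro has_vector_derivative_vecI)
    (auto simp: sl_mat_def intro!: assms has_vector_derivative_minus has_vector_derivative_sum)

lemma De_linear: "real_linear_on sl (De l)"
  and Df_linear: "real_linear_on sl (Df l)"
  by (auto simp: real_linear_on_def; rule sl_eqI; auto simp: De_def Df_def sl_add sl_scaleR)+

text \<open>Outside the last column \<open>De\<close> writes only to the row \<open>inl l\<close>,
  while it reads only the rows \<open>None\<close> and \<open>inr k\<close>. \<open>Df\<close>
  writes to the row \<open>None\<close> and reads the row \<open>inl l\<close>.\<close>

lemma De_De: "De l (De l y) = 0"
  and Df_Df: "Df l (Df l y) = 0"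
  by (rule sl_eqI; simp add: sl_zero De_def Df_def)+

text \<open>Only the determinant of the transport is remembered, so that the pieces of the loop can
  be chained as introduction rules.\<close>

definition reaches_det ::
  "(('n::finite + 'n) option) connection \<Rightarrow> (complex, 'n) mat_odd \<Rightarrow> (complex, 'n) mat_odd \<Rightarrow> real \<Rightarrow> bool" where
  "reaches_det \<Gamma> p q d \<longleftrightarrow> (\<exists>P. reaches \<Gamma> p q P \<and> real_linear_on sl P \<and> det_sl P = d)"

lemma reaches_det_step:
  fixes c :: "real \<Rightarrow> (complex, 'n::finite) mat_odd"
  assumes r: "reaches_det \<Gamma> p q d"
    and c: "\<And>t. (c has_vector_derivative c t ** X) (at t)" "c 0 = mat 1" "\<And>t. c t \<in> SL"
    and Q: "\<And>t g u. g \<in> SL \<Longrightarrow> u \<in> sl \<Longrightarrow>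
        ((\<lambda>t. Q t u) has_vector_derivative - \<Gamma> g X (Q t u)) (at t)"
      "\<And>u. u \<in> sl \<Longrightarrow> Q 0 u = u" "\<And>t u. u \<in> sl \<Longrightarrow> Q t u \<in> sl"
      "real_linear_on sl (Q 1)"
  shows "reaches_det \<Gamma> p (q ** c 1) (det_sl (Q 1) * d)"
proof -
  obtain P where P: "reaches \<Gamma> p q P" "real_linear_on sl P" "det_sl P = d"
    using r by (auto simp: reaches_det_def)
  have sl: "P u \<in> sl" if "u \<in> sl" for u
    by (rule reaches_maps_sl[OF P(1) that])
  have "reaches \<Gamma> p (q ** c 1) (\<lambda>u. Q 1 (P u))"
    by (rule reaches_step[OF P(1) c Q(1-3)])
  moreover have "real_linear_on sl (\<lambda>u. Q 1 (P u))"
    using P(2) Q(4) sl by (simp add: real_linear_on_def)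
  moreover have "det_sl (\<lambda>u. Q 1 (P u)) = det_sl (Q 1) * d"
    using det_sl_compose[OF Q(4) P(2) sl] P(3) by simp
  ultimately show ?thesis by (auto simp: reaches_det_def)
qed

lemma obata_scaleR:
  assumes "obata_connection \<Gamma>" "g \<in> SL" "x \<in> sl" "y \<in> sl"
  shows "\<Gamma> g (r *\<^sub>R x) y = r *\<^sub>R obata x y"
  using assms obata_connection_eq[OF assms]
  by (simp add: obata_connection_def affine_connection_def real_linear_on_def)

text \<open>Since \<open>D\<close> has square zero, the transport is
  \<open>exp(-t s D) = 1 - t s D\<close>, which has determinant \<open>1\<close>.\<close>

lemma reaches_det_unipotent:
  fixes \<Gamma> :: "(('n::finite + 'n) option) connection"
  assumes \<Gamma>: "obata_connection \<Gamma>" and r: "reaches_det \<Gamma> p q d" and ab: "a \<noteq> b"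
    and D: "real_linear_on sl D" "\<And>y. obata (eunit a b) y = D y" "\<And>y. D (D y) = 0"
  shows "reaches_det \<Gamma> p (q ** unipotent a b (of_real s)) d"
proof -
  let ?Q = "\<lambda>t u. u + (- (t * s)) *\<^sub>R D u"
  have sl: "D u \<in> sl" for u
    unfolding D(2)[symmetric] by (rule obata_in_sl)
  have Q_sl: "?Q t u \<in> sl" if "u \<in> sl" for t u
    by (intro sl_add sl_scaleR sl that)
  \<comment> \<open>Hence the constant derivative \<open>- s D u\<close> of \<open>?Q t u\<close>
    equals \<open>- s D (?Q t u)\<close>, as the transport equation demands.\<close>
  have "D (?Q t u) = D u" if "u \<in> sl" for t u
    using D(1) that sl D(3) unfolding real_linear_on_def by (simp add: sl_scaleR del: scaleR_minus_left)
  then have der: "((\<lambda>t. ?Q t u) has_vector_derivative - \<Gamma> g (s *\<^sub>R eunit a b) (?Q t u)) (at t)"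
    if "g \<in> SL" "u \<in> sl" for g u t
    unfolding obata_scaleR[OF \<Gamma> that(1) eunit_in_sl[OF ab] Q_sl[OF that(2)]] D(2)
    using that by (auto intro!: derivative_eq_intros)
  have lin: "real_linear_on sl (?Q 1)"
    using D(1) by (auto simp: real_linear_on_def algebra_simps)
  have "c 0 = mat 1" if "c = (\<lambda>t. unipotent a b (of_real (t * s)))" for c
    using that by (simp add: unipotent_def mat_def)
  then have "reaches_det \<Gamma> p (q ** unipotent a b (of_real (1 * s))) (det_sl (?Q 1) * d)"
    using unipotent_derivative[OF ab, of s] unipotent_in_SL[OF ab]
    by (intro reaches_det_step[OF r, where c = "\<lambda>t. unipotent a b (of_real (t * s))"
      and X = "s *\<^sub>R eunit a b" and Q = ?Q] der Q_sl lin) auto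
  then show ?thesis
    using det_sl_unipotent[OF D(1) sl D(3), of "- s"] by simp
qed

text \<open>The transport is \<open>exp(-t s \<nabla>_h)\<close>, diagonal on the entries. Its real
  determinant at time \<open>1\<close> is \<open>exp(-2 s)\<close> raised to the sum
  \<open>2(n + 1)\<close> of the weights, the factor \<open>2\<close> coming from real and imaginary
  parts.\<close>

lemma reaches_det_torus:
  fixes \<Gamma> :: "(('n::finite + 'n) option) connection"
  assumes \<Gamma>: "obata_connection \<Gamma>" and r: "reaches_det \<Gamma> p q d"
  shows "reaches_det \<Gamma> p (q ** torus l s) (exp (- 4 * s * (real CARD('n) + 1)) * d)"
proof -
  let ?Q = "\<lambda>t (u :: (complex, 'n) mat_odd). sl_mat (\<lambda>i j. exp (- (t * s * hweight l i j)) *\<^sub>R u $ i $ j)"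
  have eq: "- (s *\<^sub>R Dh l (?Q t u)) =
      sl_mat (\<lambda>i j. (- (s * hweight l i j) * exp (- (t * s * hweight l i j))) *\<^sub>R u $ i $ j)" for t u
    by (rule sl_eqI) (simp_all add: sl_uminus sl_scaleR Dh_def)
  have der: "((\<lambda>t. ?Q t u) has_vector_derivative - \<Gamma> g (s *\<^sub>R hmat l) (?Q t u)) (at t)"
    if "g \<in> SL" for g u t
    unfolding obata_scaleR[OF \<Gamma> that hmat_in_sl sl_mat_in_sl] obata_h eq
    by (intro sl_mat_derivative) (auto intro!: derivative_eq_intros)
  have lin: "real_linear_on sl (?Q 1)"
    unfolding real_linear_on_def
    by (intro conjI ballI allI; rule sl_eqI) (auto simp: sl_add algebra_simps intro!: sl_scaleR)
  have corner: "hweight l None None = 0"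
    by (simp add: hweight_def)
  have two: "(if k = l then 2 else 1 :: real) = 1 + (if k = l then 1 else 0)" for k
    by simp
  \<comment> \<open>The columns other than the last sum to \<open>0\<close> because \<open>h\<close>
    is traceless; each half of the last column contributes \<open>n + 1\<close>.\<close>
  have sum: "(\<Sum>(i, j)\<in>UNIV \<times> UNIV. hweight l i j) = 2 * (real CARD('n) + 1)"
    unfolding sum.cartesian_product[symmetric]
    by (simp add: sum_UNIV_option sum_UNIV_sum hweight_def two sum.distrib mult_If)
  have "det_sl (?Q 1) = (\<Prod>q\<in>UNIV. if q = (None, None) then 1 else (exp (- (1 * s * hweight l (fst q) (snd q))))\<^sup>2)"
    by (rule det_sl_diagonal)
  \<comment> \<open>The exceptional factor \<open>1\<close> is absorbed as \<open>exp 0\<close>, the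
    weight at the corner being zero.\<close>
  also have "\<dots> = (\<Prod>(i, j)\<in>UNIV \<times> UNIV. exp (- (2 * s) * hweight l i j))"
    by (intro prod.cong) (auto simp: corner exp_double[symmetric])
  also have "\<dots> = exp (\<Sum>(i, j)\<in>UNIV \<times> UNIV. - (2 * s) * hweight l i j)"
    by (subst exp_sum) (auto simp: case_prod_unfold)
  also have "\<dots> = exp (- (2 * s) * (\<Sum>(i, j)\<in>UNIV \<times> UNIV. hweight l i j))"
    unfolding sum_distrib_left by (simp add: case_prod_unfold)
  finally have det: "det_sl (?Q 1) = exp (- 4 * s * (real CARD('n) + 1))"
    unfolding sum by (simp add: algebra_simps)
  have "reaches_det \<Gamma> p (q ** torus l (1 * s)) (det_sl (?Q 1) * d)"
  proof (rule reaches_det_step[OF r, where c = "\<lambda>t. torus l (t * s)" and Q = ?Q])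
    show "torus l (0 * s) = mat 1" by (simp add: torus_def mat_def cong: if_cong)
    show "?Q 0 u = u" if "u \<in> sl" for u using that by (simp add: sl_mat_self)
  qed (use torus_derivative torus_in_SL der lin in simp_all)
  then show ?thesis unfolding det by simp
qed

theorem corollary5p8:
  fixes \<Gamma> :: "(('n::finite + 'n) option) connection"
    and p :: "(complex, 'n) mat_odd"
  assumes "obata_connection \<Gamma>"
    and "p \<in> SL"
  shows "\<not> holonomy_group \<Gamma> p \<subseteq> SL_H"
proof
  assume sub: "holonomy_group \<Gamma> p \<subseteq> SL_H"
  \<comment> \<open>Types are inhabited, so there is such an index; this is
    \<open>n \<ge> 1\<close>.\<close>
  fix l :: 'n
  let ?e = "\<lambda>s. unipotent (inl l) None (of_real s)" and ?f = "\<lambda>s. unipotent None (inl l) (of_real s)"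
  \<comment> \<open>In \<open>SL_2\<close> put \<open>w(t) = e(t) f(-1/t) e(t)\<close>. Then
    \<open>w(2) w(1)^(-1) = diag(2, 1/2)\<close>. The five unipotent factors are this product with
    \<open>e(2) e(-1)\<close> merged into \<open>e(1)\<close>, and the torus factor is its
    inverse.\<close>
  let ?q = "p ** ?e 2 ** ?f (- 1 / 2) ** ?e 1 ** ?f 1 ** ?e (- 1) ** torus l (- ln 2)"
  have e: "reaches_det \<Gamma> p (q ** ?e s) d" and f: "reaches_det \<Gamma> p (q ** ?f s) d"
    if "reaches_det \<Gamma> p q d" for q s d
    using reaches_det_unipotent[OF assms(1) that _ De_linear obata_e De_De]
      reaches_det_unipotent[OF assms(1) that _ Df_linear obata_f Df_Df] by simp_all
  have "reaches_det \<Gamma> p p 1"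
    using reaches_refl[OF assms(2), of \<Gamma>] unfolding reaches_det_def
    by (intro exI[of _ "\<lambda>u. u"]) (simp add: real_linear_on_def det_sl_id)
  then have "reaches_det \<Gamma> p ?q (exp (- 4 * (- ln 2) * (real CARD('n) + 1)) * 1)"
    by (intro reaches_det_torus e f assms(1))
  moreover have "?q = p"
    by (auto simp: vec_eq_iff mult_torus_nth mult_unipotent_nth hvec_def exp_minus scaleR_conv_of_real[where 'a = complex]
        field_simps split: if_splits)
  ultimately obtain P where P: "reaches \<Gamma> p p P" "det_sl P = exp (4 * ln 2 * (real CARD('n) + 1))"
    by (auto simp: reaches_det_def)
  \<comment> \<open>Elements of \<open>holonomy_group\<close> are extensional, hence the
    restriction; it leaves \<open>det_sl\<close> unchanged.\<close>
  have "restrict P sl \<in> SL_H"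
    using reaches_holonomy[OF P(1)] sub by blast
  then have "det_sl (restrict P sl) = 1" by (rule SL_H_det_sl)
  moreover have "det_sl (restrict P sl) = det_sl P" by (rule det_sl_cong) simp
  ultimately have "4 * ln 2 * (real CARD('n) + 1) = 0" using P(2) by simp
  moreover have "ln 2 > (0 :: real)" by simp
  ultimately show False by (simp add: add_nonneg_eq_0_iff)
qed

end
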